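(* For any two groves $x,y$ of planar trees, the Left sum $x\dashv y$, the Middle sum $x\perp y$, the Right sum $x\vdash y$ and the sum $x+y$ are again groves, i.e. in each of them every tree occurs at most once.
   Context: A planar tree of degree $n\ge0$ is a planar rooted tree (up to planar isotopy) with $n+1$ leaves in which every internal vertex has at least two inputs; $T_n$ is the set of these trees, $T_0=\{|\}$. For trees $x^{(0)},\dots,x^{(k)}$ ($k\ge1$), the grafting $x^{(0)}\vee\cdots\vee x^{(k)}$ joins their roots (in this order) to a new vertex carrying a new root; every tree $x$ of positive degree decomposes uniquely as $x=x^{(0)}\vee\cdots\vee x^{(k)}$ with $k\ge1$. Grafting involving groves is done elementwise. A grove of degree $n$ is a nonempty subset of $T_n$; operations on groves are extended from trees by distributivity (union over all pairs, a priori counted with multiplicity). The sum is defined recursively: $|+x=x+|=x$, and for $x=x^{(0)}\vee\cdots\vee x^{(k)}$, $y=y^{(0)}\vee\cdots\vee y^{(\ell)}$ of positive degree, $x+y:=(x\dashv y)\cup(x\perp y)\cup(x\vdash y)$ where $x\dashv y:=x^{(0)}\vee\cdots\vee x^{(k-1)}\vee(x^{(k)}+y)$ (Left sum), $x\perp y:=x^{(0)}\vee\cdots\vee x^{(k-1)}\vee(x^{(k)}+y^{(0)})\vee y^{(1)}\vee\cdots\vee y^{(\ell)}$ (Middle sum), $x\vdash y:=(x+y^{(0)})\vee y^{(1)}\vee\cdots\vee y^{(\ell)}$ (Right sum). For $x\ne|$: $x\dashv|=x$, $|\dashv x=|$, $x\vdash|=|$, $|\vdash x=x$, $x\perp|=|\perp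 x=|$; and by convention $|\dashv|=|\vdash|=|\perp|=|$.
   Formalization: The conventions |⊣y=|, x⊢|=|, x⊥|=|⊥x=| are applied once to whole groves rather than tree by tree with multiplicity; expanded by distributivity, | would occur once per tree of the other grove and the claim would fail, e.g. for |⊣T_2. *)

theory Defs
  imports Main "HOL-Library.Multiset"
begin

text \<open>
  Planar rooted trees in which every internal vertex has at least two inputs.
  \<open>Leaf\<close> is the tree \<open>|\<close>, and \<open>Graft x0 [x1, ..., x(k-1)] xk\<close> is the grafting
  \<open>x0 \<or> x1 \<or> ... \<or> xk\<close>.  Singling out the first and the last input builds \<open>k \<ge> 1\<close> into the
  type, so every tree of positive degree is uniquely a grafting.
\<close>
datatype ptree = Leaf | Graft ptree "ptree list" ptree

primrec leaves :: "ptree \<Rightarrow> nat" where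
  "leaves Leaf = 1"
| "leaves (Graft a bs c) = leaves a + sum_list (map leaves bs) + leaves c"

definition trees_of_degree :: "nat \<Rightarrow> ptree set" where
  "trees_of_degree n = {t. leaves t = n + 1}"

definition is_grove :: "ptree set \<Rightarrow> bool" where
  "is_grove X \<longleftrightarrow> X \<noteq> {} \<and> (\<exists>n. X \<subseteq> trees_of_degree n)"

text \<open>
  Unions are a priori counted with multiplicity, so the operations produce multisets of trees;
  such a multiset is a grove if its trees form a grove and each of them occurs only once.
\<close>
definition is_grove_mset :: "ptree multiset \<Rightarrow> bool" where
  "is_grove_mset M \<longleftrightarrow> is_grove (set_mset M) \<and> (\<forall>t. count M t \<le> 1)"

fun tree_sum :: "ptree \<Rightarrow> ptree \<Rightarrow> ptree multiset"
  and tree_left :: "ptree \<Rightarrow> ptree \<Rightarrow> ptree multiset"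
  and tree_middle :: "ptree \<Rightarrow> ptree \<Rightarrow> ptree multiset"
  and tree_right :: "ptree \<Rightarrow> ptree \<Rightarrow> ptree multiset"
where
  "tree_sum Leaf y = {#y#}"
| "tree_sum (Graft a bs c) Leaf = {#Graft a bs c#}"
| "tree_sum (Graft a bs c) (Graft d es f) =
     tree_left (Graft a bs c) (Graft d es f)
   + tree_middle (Graft a bs c) (Graft d es f)
   + tree_right (Graft a bs c) (Graft d es f)"
| "tree_left Leaf y = {#Leaf#}"
| "tree_left (Graft a bs c) Leaf = {#Graft a bs c#}"
| "tree_left (Graft a bs c) (Graft d es f) =
     {#Graft a bs t. t \<in># tree_sum c (Graft d es f)#}"
| "tree_middle Leaf y = {#Leaf#}"
| "tree_middle (Graft a bs c) Leaf = {#Leaf#}"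
| "tree_middle (Graft a bs c) (Graft d es f) =
     {#Graft a (bs @ [t] @ es) f. t \<in># tree_sum c d#}"
| "tree_right Leaf y = {#y#}"
| "tree_right (Graft a bs c) Leaf = {#Leaf#}"
| "tree_right (Graft a bs c) (Graft d es f) =
     {#Graft t es f. t \<in># tree_sum (Graft a bs c) d#}"

definition distributive ::
  "(ptree \<Rightarrow> ptree \<Rightarrow> ptree multiset) \<Rightarrow> ptree set \<Rightarrow> ptree set \<Rightarrow> ptree multiset" where
  "distributive f X Y = (\<Sum>x\<in>X. \<Sum>y\<in>Y. f x y)"

text \<open>
  The conventions \<open>| \<stileturn> x = |\<close>, \<open>x \<turnstile> | = |\<close> and \<open>x \<bottom> | = | \<bottom> x = |\<close> are read for groves \<open>x\<close>.
  Expanding them distributively would instead produce one copy of \<open>|\<close> for each tree of \<open>x\<close>.  In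
  all other cases the operations are the distributive extensions of those on trees.
\<close>
definition grove_sum :: "ptree set \<Rightarrow> ptree set \<Rightarrow> ptree multiset" where
  "grove_sum X Y = distributive tree_sum X Y"

definition grove_left :: "ptree set \<Rightarrow> ptree set \<Rightarrow> ptree multiset" where
  "grove_left X Y = (if X = {Leaf} then {#Leaf#} else distributive tree_left X Y)"

definition grove_middle :: "ptree set \<Rightarrow> ptree set \<Rightarrow> ptree multiset" where
  "grove_middle X Y =
     (if X = {Leaf} \<or> Y = {Leaf} then {#Leaf#} else distributive tree_middle X Y)"

text \<open>On trees, \<open>| \<turnstile> | = |\<close> agrees with both \<open>x \<turnstile> | = |\<close> and \<open>| \<turnstile> y = y\<close>.\<close>
definition grove_right :: "ptree set \<Rightarrow> ptree set \<Rightarrow> ptree multiset" where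
  "grove_right X Y = (if Y = {Leaf} then {#Leaf#} else distributive tree_right X Y)"

lemma grove_operations_singleton:
  "grove_sum {x} {y} = tree_sum x y"
  "grove_left {x} {y} = tree_left x y"
  "grove_middle {x} {y} = tree_middle x y"
  "grove_right {x} {y} = tree_right x y"
  by (cases x; cases y;
      simp add: grove_sum_def grove_left_def grove_middle_def grove_right_def distributive_def)+

end

theory Submission imports Defs begin

text \<open>
  A tree \<open>z\<close> of \<open>x + y\<close> determines \<open>x\<close> and \<open>y\<close> once the degree \<open>m\<close> of \<open>x\<close> is known.  If \<open>x\<close> and
  \<open>y\<close> have positive degree, one input \<open>t\<close> of the root of \<open>z\<close> belongs to a sum \<open>u + v\<close> and the
  others are inputs of \<open>x\<close> or \<open>y\<close>; this \<open>t\<close> is the input containing the leaf number \<open>m\<close> of \<open>z\<close>,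
  counted from \<open>0\<close>.  It is the last one in the Left sum, an inner one in the Middle sum and the
  first one in the Right sum, so these are disjoint.  Moreover the degree of \<open>u\<close> is known, so that
  induction recovers \<open>u\<close> and \<open>v\<close>, hence \<open>x\<close> and \<open>y\<close>.
\<close>

section \<open>Leaf counts and finiteness of groves\<close>

lemma leaves_pos: "0 < leaves t"
  by (induction t) auto

lemma leaves_eq_1_iff: "leaves t = 1 \<longleftrightarrow> t = Leaf"
proof (cases t)
  case (Graft a bs c)
  then show ?thesis
    using leaves_pos[of a] leaves_pos[of c] by simp
qed simp

lemma length_le_sum_leaves: "length ts \<le> sum_list (map leaves ts)"
proof (induction ts)
  case (Cons t ts)
  then show ?case using leaves_pos[of t] by simp
qed simp

text \<open>The first and the last input of a root both carry a leaf, so every input has fewer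
  leaves than the tree. Finiteness matters because a sum over an infinite set is \<open>{#}\<close>
  by default.\<close>

lemma finite_leaves_le: "finite {t. leaves t \<le> n}"
proof (induction n)
  case 0
  have "{t. leaves t \<le> 0} = {}"
    using leaves_pos by (simp add: Collect_empty_eq)
  then show ?case by (simp only: finite.emptyI)
next
  case (Suc n)
  let ?S = "{t. leaves t \<le> n}"
  let ?L = "{bs. set bs \<subseteq> ?S \<and> length bs \<le> n}"
  have "{t. leaves t \<le> Suc n} \<subseteq> insert Leaf ((\<lambda>(a, bs, c). Graft a bs c) ` (?S \<times> ?L \<times> ?S))"
  proof
    fix t assume t: "t \<in> {t. leaves t \<le> Suc n}"
    show "t \<in> insert Leaf ((\<lambda>(a, bs, c). Graft a bs c) ` (?S \<times> ?L \<times> ?S))"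
    proof (cases t)
      case (Graft a bs c)
      have le: "leaves a + sum_list (map leaves bs) + leaves c \<le> Suc n"
        using t Graft by simp
      have pos: "0 < leaves a" "0 < leaves c" by (rule leaves_pos)+
      have "leaves b \<le> n" if "b \<in> set bs" for b
        using member_le_sum_list[of "leaves b" "map leaves bs"] that le pos by simp
      then have "(a, bs, c) \<in> ?S \<times> ?L \<times> ?S"
        using le pos length_le_sum_leaves[of bs] by auto
      then show ?thesis unfolding Graft by (intro insertI2 rev_image_eqI[of "(a, bs, c)"]) simp_all
    qed simp
  qed
  moreover have "finite ?L"
    using Suc by (rule finite_lists_length_le)
  ultimately show ?case
    using Suc by (auto intro: finite_subset)
qed

lemma is_grove_finite: "is_grove X \<Longrightarrow> finite X"
  unfolding is_grove_def trees_of_degree_def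
  using finite_leaves_le by (metis (mono_tags, lifting) finite_subset mem_Collect_eq order_refl subset_iff)

text \<open>All trees of a grove have the same degree, and only \<open>Leaf\<close> has degree
  0.\<close>

lemma is_grove_Leaf: "is_grove X \<Longrightarrow> Leaf \<in> X \<Longrightarrow> X = {Leaf}"
  unfolding is_grove_def trees_of_degree_def
  using leaves_eq_1_iff by (fastforce simp: subset_iff)

section \<open>Sums of two trees and recovery of the summands\<close>

lemma tree_sum_Leaf_right [simp]: "tree_sum x Leaf = {#x#}"
  by (cases x) auto

text \<open>Replaces the mutual induction over four operations by one for \<open>tree_sum\<close>
  alone; the hypotheses are the sums inside the Left, Middle and Right sum.\<close>

lemma tree_sum_induct [case_names Leaf_left Leaf_right Graft]:
  assumes "\<And>y. P Leaf y"
    and "\<And>a bs c. P (Graft a bs c) Leaf"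
    and "\<And>a bs c d es f. P c (Graft d es f) \<Longrightarrow> P c d \<Longrightarrow> P (Graft a bs c) d \<Longrightarrow>
           P (Graft a bs c) (Graft d es f)"
  shows "P x y"
  using assms by induction_schema (pat_completeness, lexicographic_order)

lemma leaves_tree_sum: "z \<in># tree_sum x y \<Longrightarrow> Suc (leaves z) = leaves x + leaves y"
  by (induction x y arbitrary: z rule: tree_sum_induct) fastforce+

lemma tree_sum_nonempty: "tree_sum x y \<noteq> {#}"
  by (induction x y rule: tree_sum_induct) auto

text \<open>
  The convention \<open>join [t] = t\<close> lets one splitting lemma, \<open>tree_sum_split\<close> below, cover the Left,
  Middle and Right sum.  The value of \<open>join []\<close> is junk.
\<close>

definition join :: "ptree list \<Rightarrow> ptree" where
  "join ts = (if length ts = 1 then hd ts else Graft (hd ts) (butlast (tl ts)) (last ts))"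

fun children :: "ptree \<Rightarrow> ptree list" where
  "children Leaf = []"
| "children (Graft a bs c) = a # bs @ [c]"

lemma join_single [simp]: "join [t] = t"
  by (simp add: join_def)

lemma join_snoc [simp]: "join (a # bs @ [c]) = Graft a bs c"
  by (simp add: join_def)

lemma leaves_join: "ts \<noteq> [] \<Longrightarrow> leaves (join ts) = sum_list (map leaves ts)"
  by (cases ts; cases "tl ts" rule: rev_cases) auto

lemma size_children: "t \<in> set (children z) \<Longrightarrow> size t < size z"
  by (cases z) (auto dest: size_list_estimation'[OF _ order_refl, where f = size])

lemma tree_sum_split:
  assumes "z \<in># tree_sum x y" "x \<noteq> Leaf" "y \<noteq> Leaf"
  obtains ps u t v qs where "children z = ps @ t # qs" "t \<in># tree_sum u v"
    "x = join (ps @ [u])" "y = join (v # qs)"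
proof -
  obtain a bs c d es f where xy: "x = Graft a bs c" "y = Graft d es f"
    using assms(2,3) by (metis ptree.exhaust)
  consider (left) t where "t \<in># tree_sum c y" "z = Graft a bs t"
    | (middle) t where "t \<in># tree_sum c d" "z = Graft a (bs @ [t] @ es) f"
    | (right) t where "t \<in># tree_sum x d" "z = Graft t es f"
    using assms(1) unfolding xy by auto
  then show thesis
  proof cases
    case left
    \<comment> \<open>No input of \<open>y\<close> is left over: \<open>v\<close> is
      \<open>y\<close> itself, since \<open>join [y] = y\<close>.\<close>
    then show thesis using xy by (intro that[of "a # bs" t "[]" c y]) auto
  next
    case middle
    then show thesis using xy by (intro that[of "a # bs" t "es @ [f]" c d]) auto
  next
    case right
    then show thesis using xy by (intro that[of "[]" t "es @ [f]" x d]) auto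
  qed
qed

text \<open>Lay the entries end to end as half-open intervals of length \<open>w\<close>: at most
  one of them contains position \<open>m\<close>.\<close>

lemma append_Cons_unique_by_weight:
  fixes w :: "'a \<Rightarrow> nat"
  assumes "ps @ t # qs = ps' @ t' # qs'"
    and "sum_list (map w ps) \<le> m" "m < sum_list (map w ps) + w t"
    and "sum_list (map w ps') \<le> m" "m < sum_list (map w ps') + w t'"
  shows "ps = ps' \<and> t = t' \<and> qs = qs'"
  using assms
proof (induction ps arbitrary: ps' m)
  case Nil
  then show ?case by (cases ps') auto
next
  case (Cons p ps)
  show ?case
  proof (cases ps')
    case Nil
    with Cons.prems show ?thesis by auto
  next
    case (Cons p' qs'')
    \<comment> \<open>Both lists start with the same entry; dropping it moves the position back by
      its weight.\<close>
    with Cons.prems Cons.IH[of qs'' "m - w p"] show ?thesis by auto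
  qed
qed

text \<open>Think of \<open>s\<close> as the number of leaves before \<open>t\<close>. As
  \<open>t\<close> has \<open>leaves u + leaves v - 1\<close> leaves and \<open>u\<close>,
  \<open>v\<close> have at least one each, leaf number \<open>leaves x - 1\<close> lies in
  \<open>t\<close>.\<close>

lemma tree_sum_bounds:
  assumes "t \<in># tree_sum u v" "leaves x = s + leaves u"
  shows "s \<le> leaves x - 1" "leaves x - 1 < s + leaves t"
  using leaves_tree_sum[OF assms(1)] assms(2) leaves_pos[of u] leaves_pos[of v] by linarith+

lemma tree_sum_unique:
  assumes "z \<in># tree_sum x y" "z \<in># tree_sum x' y'" "leaves x = leaves x'"
  shows "x = x' \<and> y = y'"
  using assms
proof (induction "size z" arbitrary: z x y x' y' rule: less_induct)
  case less
  have lv: "leaves y = leaves y'"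
    using leaves_tree_sum[OF less.prems(1)] leaves_tree_sum[OF less.prems(2)] less.prems(3)
    by simp
  \<comment> \<open>Equal leaf counts rule out that only one of \<open>x\<close>, \<open>x'\<close>,
    or only one of \<open>y\<close>, \<open>y'\<close>, is \<open>Leaf\<close>.\<close>
  consider (x) "x = Leaf" "x' = Leaf" | (y) "y = Leaf" "y' = Leaf"
    | (graft) "x \<noteq> Leaf" "x' \<noteq> Leaf" "y \<noteq> Leaf" "y' \<noteq> Leaf"
    using leaves_eq_1_iff less.prems(3) lv by metis
  then show ?case
  proof cases
    case graft
    obtain ps u t v qs where s: "children z = ps @ t # qs" "t \<in># tree_sum u v"
        "x = join (ps @ [u])" "y = join (v # qs)"
      using tree_sum_split[OF less.prems(1)] graft by metis
    obtain ps' u' t' v' qs' where s': "children z = ps' @ t' # qs'" "t' \<in># tree_sum u' v'"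
        "x' = join (ps' @ [u'])" "y' = join (v' # qs')"
      using tree_sum_split[OF less.prems(2)] graft by metis
    have lx: "leaves x = sum_list (map leaves ps) + leaves u"
        "leaves x = sum_list (map leaves ps') + leaves u'"
      using less.prems(3) s(3) s'(3) by (simp_all add: leaves_join)
    have eq: "ps = ps' \<and> t = t' \<and> qs = qs'"
      using append_Cons_unique_by_weight[of ps t qs ps' t' qs' leaves "leaves x - 1"]
        tree_sum_bounds[OF s(2) lx(1)] tree_sum_bounds[OF s'(2) lx(2)] s(1) s'(1)
      by simp
    have "size t < size z"
      using s(1) by (intro size_children) simp
    \<comment> \<open>With \<open>ps = ps'\<close>, the two equations \<open>lx\<close> give
      \<open>leaves u = leaves u'\<close>, as the induction hypothesis requires.\<close>
    then have "u = u' \<and> v = v'"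
      using less.hyps[of t u v u' v'] s(2) s'(2) eq lx by simp
    then show ?thesis using s s' eq by simp
  qed (use less.prems in auto)
qed

section \<open>Multiplicities within the sum of two trees\<close>

lemma sum_le_1_if_unique:
  fixes g :: "'a \<Rightarrow> nat"
  assumes "\<And>a. a \<in> A \<Longrightarrow> g a \<le> 1"
    and "\<And>a b. a \<in> A \<Longrightarrow> b \<in> A \<Longrightarrow> 0 < g a \<Longrightarrow> 0 < g b \<Longrightarrow> a = b"
  shows "sum g A \<le> 1"
proof (cases "finite A \<and> (\<exists>a\<in>A. 0 < g a)")
  case True
  then obtain a where a: "finite A" "a \<in> A" "0 < g a" by auto
  then have "sum g (A - {a}) = 0"
    using assms(2) by (auto simp: sum_eq_0_iff)
  then show ?thesis
    using a assms(1) by (simp add: sum.remove)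
\<comment> \<open>Either all terms are 0, or \<open>A\<close> is infinite and the sum is 0 by
  default.\<close>
qed (cases "finite A", auto)

lemma count_image_mset_inj_le_1:
  assumes "inj g" "\<And>t. count M t \<le> 1"
  shows "count (image_mset g M) z \<le> 1"
  unfolding count_image_mset'
  using assms by (intro sum_le_1_if_unique) (auto dest: injD)

lemma tree_left_middle_right_disjoint:
  fixes a bs c d es f
  defines "x \<equiv> Graft a bs c" and "y \<equiv> Graft d es f"
  shows "\<not> (z \<in># tree_left x y \<and> z \<in># tree_middle x y)"
    and "\<not> (z \<in># tree_left x y \<and> z \<in># tree_right x y)"
    and "\<not> (z \<in># tree_middle x y \<and> z \<in># tree_right x y)"
proof -
  let ?m = "leaves x - 1"
  let ?D = "\<lambda>ps qs. \<exists>t. children z = ps @ t # qs \<and> sum_list (map leaves ps) \<le> ?m \<and>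
              ?m < sum_list (map leaves ps) + leaves t"
  have unique: "ps = ps' \<and> qs = qs'" if "?D ps qs" "?D ps' qs'" for ps qs ps' qs'
    using that append_Cons_unique_by_weight by metis
  have split: "?D ps qs"
    if "t \<in># tree_sum u v" "children z = ps @ t # qs" "x = join (ps @ [u])" for ps qs t u v
  proof -
    have "leaves x = sum_list (map leaves ps) + leaves u"
      using that(3) by (simp add: leaves_join)
    then show ?thesis using tree_sum_bounds[OF that(1)] that(2) by blast
  qed
  have left: "?D (a # bs) []" if z: "z \<in># tree_left x y"
  proof -
    obtain t where "t \<in># tree_sum c y" "z = Graft a bs t"
      using z by (auto simp: x_def y_def)
    then show ?thesis by (intro split) (auto simp: x_def)
  qed
  have middle: "?D (a # bs) (es @ [f])" if z: "z \<in># tree_middle x y"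
  proof -
    obtain t where "t \<in># tree_sum c d" "z = Graft a (bs @ [t] @ es) f"
      using z by (auto simp: x_def y_def)
    then show ?thesis by (intro split) (auto simp: x_def)
  qed
  have right: "?D [] (es @ [f])" if z: "z \<in># tree_right x y"
  proof -
    obtain t where "t \<in># tree_sum x d" "z = Graft t es f"
      using z by (auto simp: x_def y_def)
    then show ?thesis by (intro split) auto
  qed
  \<comment> \<open>The pairs \<open>(ps, qs)\<close> found differ: only the Left sum has empty
    \<open>qs\<close>, and only the Right sum has empty \<open>ps\<close>.\<close>
  show "\<not> (z \<in># tree_left x y \<and> z \<in># tree_middle x y)"
    using left middle unique by blast
  show "\<not> (z \<in># tree_left x y \<and> z \<in># tree_right x y)"
    using left right unique by blast
  show "\<not> (z \<in># tree_middle x y \<and> z \<in># tree_right x y)"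
    using middle right unique by blast
qed

text \<open>Each of the three parts is the image of a smaller sum under an injective grafting map,
  and no tree lies in two of them.\<close>

lemma count_tree_sum_le_1: "count (tree_sum x y) z \<le> 1"
proof (induction x y arbitrary: z rule: tree_sum_induct)
  case (Graft a bs c d es f)
  let ?x = "Graft a bs c" and ?y = "Graft d es f"
  have "count (tree_left ?x ?y) z \<le> 1"
    unfolding tree_left.simps by (rule count_image_mset_inj_le_1[OF _ Graft(1)]) (auto intro: injI)
  moreover have "count (tree_middle ?x ?y) z \<le> 1"
    unfolding tree_middle.simps by (rule count_image_mset_inj_le_1[OF _ Graft(2)]) (auto intro: injI)
  moreover have "count (tree_right ?x ?y) z \<le> 1"
    unfolding tree_right.simps by (rule count_image_mset_inj_le_1[OF _ Graft(3)]) (auto intro: injI)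
  moreover have "count (tree_sum ?x ?y) z =
      count (tree_left ?x ?y) z + count (tree_middle ?x ?y) z + count (tree_right ?x ?y) z"
    by (simp only: tree_sum.simps count_union)
  ultimately show ?case
    using tree_left_middle_right_disjoint[of z a bs c d es f]
    unfolding count_greater_zero_iff[symmetric] by linarith
qed auto

section \<open>From trees to groves\<close>

lemma distributive_eq_sum_prod: "distributive f X Y = (\<Sum>(x, y)\<in>X \<times> Y. f x y)"
  by (simp add: distributive_def sum.cartesian_product)

text \<open>Stated for a general \<open>f\<close> to serve all four operations. Different pairs
  share no tree by \<open>tree_sum_unique\<close>, since all trees of \<open>X\<close> have the same
  degree.\<close>

lemma is_grove_mset_distributive:
  assumes X: "is_grove X" and Y: "is_grove Y"
    and sub: "\<And>x y. x \<in> X \<Longrightarrow> y \<in> Y \<Longrightarrow> f x y \<subseteq># tree_sum x y"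
    and ne: "\<And>x y. x \<in> X \<Longrightarrow> y \<in> Y \<Longrightarrow> f x y \<noteq> {#}"
  shows "is_grove_mset (distributive f X Y)"
proof -
  obtain m n where m: "X \<subseteq> trees_of_degree m" and n: "Y \<subseteq> trees_of_degree n"
    using X Y unfolding is_grove_def by auto
  have fin: "finite (X \<times> Y)"
    using X Y is_grove_finite by blast
  have set: "set_mset (distributive f X Y) = (\<Union>(x, y)\<in>X \<times> Y. set_mset (f x y))"
    using fin by (auto simp: distributive_eq_sum_prod set_mset_sum)
  have mem: "z \<in># tree_sum x y" if "x \<in> X" "y \<in> Y" "z \<in># f x y" for x y z
    using mset_subset_eqD[OF sub] that by blast
  have "set_mset (distributive f X Y) \<noteq> {}"
    using X Y ne unfolding set is_grove_def by fastforce
  moreover have "set_mset (distributive f X Y) \<subseteq> trees_of_degree (m + n)"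
    using leaves_tree_sum[OF mem] m n unfolding set trees_of_degree_def by fastforce
  moreover have "count (distributive f X Y) z \<le> 1" for z
  proof -
    have "count (f x y) z \<le> 1" if "x \<in> X" "y \<in> Y" for x y
      using mset_subset_eq_count[OF sub[OF that], of z] count_tree_sum_le_1[of x y z] by linarith
    moreover have "x = x' \<and> y = y'"
      if "x \<in> X" "y \<in> Y" "x' \<in> X" "y' \<in> Y" "0 < count (f x y) z" "0 < count (f x' y') z"
      for x y x' y'
    proof (rule tree_sum_unique)
      show "z \<in># tree_sum x y" "z \<in># tree_sum x' y'"
        using mem that by simp_all
      show "leaves x = leaves x'"
        using m \<open>x \<in> X\<close> \<open>x' \<in> X\<close> by (auto simp: trees_of_degree_def subset_iff)
    qed
    ultimately have "(\<Sum>(x, y)\<in>X \<times> Y. count (f x y) z) \<le> 1"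
      by (intro sum_le_1_if_unique) (auto split: prod.splits)
    then show ?thesis
      by (simp add: distributive_eq_sum_prod count_sum case_prod_unfold)
  qed
  ultimately show ?thesis
    unfolding is_grove_mset_def is_grove_def by blast
qed

text \<open>For \<open>x = Leaf\<close> and \<open>y \<noteq> Leaf\<close> the inclusion fails: the
  Left sum is \<open>{#Leaf#}\<close>, the sum is \<open>{#y#}\<close>.\<close>

lemma tree_left_subseteq_tree_sum: "x \<noteq> Leaf \<Longrightarrow> tree_left x y \<subseteq># tree_sum x y"
  by (cases x; cases y) (simp_all del: tree_left.simps(3) tree_middle.simps(3) tree_right.simps(3))

lemma tree_middle_subseteq_tree_sum:
  "x \<noteq> Leaf \<Longrightarrow> y \<noteq> Leaf \<Longrightarrow> tree_middle x y \<subseteq># tree_sum x y"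
  by (cases x; cases y) (simp_all del: tree_left.simps(3) tree_middle.simps(3) tree_right.simps(3))

lemma tree_right_subseteq_tree_sum: "y \<noteq> Leaf \<Longrightarrow> tree_right x y \<subseteq># tree_sum x y"
  by (cases x; cases y) (simp_all del: tree_left.simps(3) tree_middle.simps(3) tree_right.simps(3))

lemma tree_left_nonempty: "tree_left x y \<noteq> {#}"
  by (cases x; cases y) (simp_all add: tree_sum_nonempty)

lemma tree_middle_nonempty: "tree_middle x y \<noteq> {#}"
  by (cases x; cases y) (simp_all add: tree_sum_nonempty)

lemma tree_right_nonempty: "tree_right x y \<noteq> {#}"
  by (cases x; cases y) (simp_all add: tree_sum_nonempty del: tree_sum.simps)

lemma is_grove_mset_Leaf: "is_grove_mset {#Leaf#}"
  unfolding is_grove_mset_def is_grove_def trees_of_degree_def by (auto intro: exI[of _ 0])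

theorem theorem9p5:
  fixes X Y :: "ptree set"
  assumes "is_grove X" and "is_grove Y"
  shows "is_grove_mset (grove_left X Y)
       \<and> is_grove_mset (grove_middle X Y)
       \<and> is_grove_mset (grove_right X Y)
       \<and> is_grove_mset (grove_sum X Y)"
proof -
  note distr = is_grove_mset_distributive[OF assms]
  note X = is_grove_Leaf[OF assms(1)] and Y = is_grove_Leaf[OF assms(2)]
  \<comment> \<open>Unless \<open>X = {Leaf}\<close>, no tree of \<open>X\<close> is
    \<open>Leaf\<close>, so the inclusion into \<open>tree_sum\<close> applies to every
    pair.\<close>
  have "is_grove_mset (grove_left X Y)"
    unfolding grove_left_def
    by (auto intro!: distr is_grove_mset_Leaf tree_left_subseteq_tree_sum tree_left_nonempty dest: X)
  moreover have "is_grove_mset (grove_middle X Y)"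
    unfolding grove_middle_def
    by (auto intro!: distr is_grove_mset_Leaf tree_middle_subseteq_tree_sum tree_middle_nonempty
        dest: X Y)
  moreover have "is_grove_mset (grove_right X Y)"
    unfolding grove_right_def
    by (auto intro!: distr is_grove_mset_Leaf tree_right_subseteq_tree_sum tree_right_nonempty dest: Y)
  moreover have "is_grove_mset (grove_sum X Y)"
    unfolding grove_sum_def by (auto intro!: distr simp: tree_sum_nonempty)
  ultimately show ?thesis by blast
qed

end
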